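(* Let $k$ be a field of characteristic zero and let $A=k\langle x,y\rangle/\langle x^2,\,y^2-xy\rangle$. The Koszul homology of $A$ is given by: 1. $HK_0(A)$ is $4$-dimensional, generated by the classes of $1$, $x$, $y$ and $xy$; 2. $HK_1(A)$ is $3$-dimensional, generated by the classes of $1\otimes x$, $1\otimes y$ and $y\otimes y$; 3. $HK_2(A)$ is $3$-dimensional, generated by the classes of $x\otimes x^2$, $yx\otimes x^2+(xy+yx)\otimes(y^2-xy)$ and $xyx\otimes(y^2-xy)$; 4. for any $p\ge3$ odd (resp. even), $HK_p(A)$ is $1$-dimensional, generated by the class of $1\otimes x^p$ (resp. $x\otimes x^p$).
   Context: Here $A=T(V)/(R)$ with $V=k.x\oplus k.y$ and $R\subseteq V\otimes V$ spanned by $x^2=x\otimes x$ and $y^2-xy=y\otimes y-x\otimes y$. For a quadratic algebra $A=T(V)/(R)$: $W_0=k$, $W_1=V$, $W_p=\bigcap_{i+2+j=p}V^{\otimes i}\otimes R\otimes V^{\otimes j}$ for $p\ge2$ (here $W_p=k.x^p$ for $p\ge3$). Elements of $W_p$ are written $x_1\ldots x_p$ (a sum of such tensors, $x_i\in V$). Koszul homology $HK_\bullet(A)$ is the homology of $(A\otimes W_\bullet,b_K)$, $b_K(a\otimes x_1\ldots x_p)=ax_1\otimes x_2\ldots x_p+(-1)^px_pa\otimes x_1\ldots x_{p-1}$ (and $0$ for $p=0$). *)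

theory Defs
  imports "HOL-Library.Poly_Mapping" "Jordan_Normal_Form.VS_Connect"
begin

section \<open>The tensor algebra of a vector space with a given basis\<close>

text \<open>Words form a monoid under concatenation, so that the convolution product on finitely
  supported functions on words is the product of the free algebra.\<close>

instantiation list :: (type) monoid_add
begin
definition zero_list :: "'a list" where "0 = []"
definition plus_list :: "'a list \<Rightarrow> 'a list \<Rightarrow> 'a list" where "u + v = u @ v"
instance by standard (simp_all add: zero_list_def plus_list_def)
end

text \<open>If \<open>V\<close> is the \<open>'k\<close>-vector space with basis \<open>'v\<close>, then \<open>T(V)\<close> is the free algebra on \<open>'v\<close>,
  the basis vector \<open>v\<^sub>1 \<otimes> \<dots> \<otimes> v\<^sub>p\<close> being the word \<open>[v\<^sub>1, \<dots>, v\<^sub>p]\<close>.  The product of \<open>T(V)\<close> is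
  the tensor product: for \<open>f\<close> in \<open>V\<^sup>\<otimes>\<^sup>p\<close> and \<open>g\<close> in \<open>V\<^sup>\<otimes>\<^sup>q\<close>, \<open>f * g\<close> is \<open>f \<otimes> g\<close>.\<close>

type_synonym ('v, 'k) tensor_alg = "'v list \<Rightarrow>\<^sub>0 'k"

definition gen :: "'v \<Rightarrow> ('v, 'k::field) tensor_alg" where
  "gen v = Poly_Mapping.single [v] 1"

definition tscale :: "'k \<Rightarrow> ('v, 'k::field) tensor_alg \<Rightarrow> ('v, 'k) tensor_alg" where
  "tscale c f = Poly_Mapping.map (\<lambda>a. c * a) f"

lemma lookup_tscale [simp]: "Poly_Mapping.lookup (tscale c f) w = c * Poly_Mapping.lookup f w"
  by (simp add: tscale_def Poly_Mapping.map.rep_eq when_def)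

interpretation tensor: vector_space "tscale :: 'k::field \<Rightarrow> ('v, 'k) tensor_alg \<Rightarrow> _"
  by unfold_locales (auto intro!: poly_mapping_eqI simp: lookup_add algebra_simps)

definition tpow :: "nat \<Rightarrow> ('v, 'k::field) tensor_alg set" where
  "tpow p = {f. \<forall>w \<in> Poly_Mapping.keys f. length w = p}"

text \<open>The spaces \<open>W\<^sub>p\<close> of a quadratic algebra \<open>T(V)/(R)\<close>; the span below is
  \<open>V\<^sup>\<otimes>\<^sup>i \<otimes> R \<otimes> V\<^sup>\<otimes>\<^sup>j\<close>.\<close>

definition koszul_W ::
    "('v, 'k::field) tensor_alg set \<Rightarrow> nat \<Rightarrow> ('v, 'k) tensor_alg set" where
  "koszul_W R p =
     (if p < 2 then tpow p
      else \<Inter>{tensor.span {u * r * v | u r v. u \<in> tpow i \<and> r \<in> R \<and> v \<in> tpow j} | i j. i + 2 + j = p})"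


section \<open>The algebra \<open>A\<close>\<close>

inductive_set ideal_gen :: "'r::ring_1 set \<Rightarrow> 'r set" for S :: "'r set" where
  zero: "0 \<in> ideal_gen S"
| incl: "r \<in> S \<Longrightarrow> r \<in> ideal_gen S"
| add: "f \<in> ideal_gen S \<Longrightarrow> g \<in> ideal_gen S \<Longrightarrow> f + g \<in> ideal_gen S"
| mult_left: "f \<in> ideal_gen S \<Longrightarrow> a * f \<in> ideal_gen S"
| mult_right: "f \<in> ideal_gen S \<Longrightarrow> f * a \<in> ideal_gen S"

lemma ideal_gen_uminus: "f \<in> ideal_gen S \<Longrightarrow> - f \<in> ideal_gen S"
  using ideal_gen.mult_left[of f S "- 1"] by simp

datatype letter = X | Y

definition rels :: "(letter, 'k::field) tensor_alg set" where
  "rels = tensor.span {gen X * gen X, gen Y * gen Y - gen X * gen Y}"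

quotient_type (overloaded) 'k A =
  "(letter, 'k::field) tensor_alg" / "\<lambda>f g. f - g \<in> ideal_gen rels"
  morphisms rep_A proj_A
proof (rule equivpI)
  show "reflp (\<lambda>f g. f - g \<in> ideal_gen rels)"
    by (simp add: reflp_def ideal_gen.zero)
  show "symp (\<lambda>f g. f - g \<in> ideal_gen rels)"
    by (metis (no_types, lifting) ideal_gen_uminus minus_diff_eq sympI)
  show "transp (\<lambda>f g. f - g \<in> ideal_gen rels)"
    by (rule transpI) (metis (no_types, lifting) diff_add_cancel add_diff_eq ideal_gen.add)
qed

lemma tscale_conv_mult: "tscale c f = Poly_Mapping.single [] c * f"
proof (rule poly_mapping_eqI)
  fix w
  have "Poly_Mapping.lookup (Poly_Mapping.single 0 c * f) w = c * Poly_Mapping.lookup f w"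
    unfolding lookup_mult
    by (simp add: lookup_single when_mult)
  then show "Poly_Mapping.lookup (tscale c f) w
      = Poly_Mapping.lookup (Poly_Mapping.single [] c * f) w"
    by (simp add: zero_list_def)
qed

lemma lookup_mult_Nil:
  "Poly_Mapping.lookup (f * g) [] = Poly_Mapping.lookup f [] * (Poly_Mapping.lookup g [] :: 'k::field)"
proof -
  have "(\<Sum>q. Poly_Mapping.lookup g q when [] = l + q) = (Poly_Mapping.lookup g [] when l = [])" for l
    by (cases "l = []") (simp_all add: plus_list_def)
  then show ?thesis
    unfolding lookup_mult by (simp add: mult_when)
qed

lemma lookup_rels_Nil: "f \<in> rels \<Longrightarrow> Poly_Mapping.lookup f [] = 0"
  unfolding rels_def
  by (induct rule: tensor.span_induct_alt)
     (auto simp: lookup_add lookup_minus lookup_mult_Nil gen_def lookup_single)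

lemma lookup_ideal_Nil: "f \<in> ideal_gen rels \<Longrightarrow> Poly_Mapping.lookup f [] = 0"
  by (induct rule: ideal_gen.induct) (auto simp: lookup_rels_Nil lookup_add lookup_mult_Nil)

instantiation A :: (field) ring_1
begin

lift_definition zero_A :: "'a A" is 0 .
lift_definition one_A :: "'a A" is 1 .
lift_definition plus_A :: "'a A \<Rightarrow> 'a A \<Rightarrow> 'a A" is "(+)"
  by (metis (no_types, lifting) add_diff_add ideal_gen.add)
lift_definition uminus_A :: "'a A \<Rightarrow> 'a A" is uminus
  by (metis (no_types, lifting) ideal_gen_uminus minus_diff_minus)
lift_definition minus_A :: "'a A \<Rightarrow> 'a A \<Rightarrow> 'a A" is "(-)"
proof -
  fix f f' g g' :: "(letter, 'a) tensor_alg"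
  assume "f - f' \<in> ideal_gen rels" "g - g' \<in> ideal_gen rels"
  then have "(f - f') + - (g - g') \<in> ideal_gen rels"
    by (intro ideal_gen.add ideal_gen_uminus)
  then show "f - g - (f' - g') \<in> ideal_gen rels"
    by (simp add: algebra_simps)
qed
lift_definition times_A :: "'a A \<Rightarrow> 'a A \<Rightarrow> 'a A" is "(*)"
proof -
  fix f f' g g' :: "(letter, 'a) tensor_alg"
  assume "f - f' \<in> ideal_gen rels" "g - g' \<in> ideal_gen rels"
  then have "(f - f') * g + f' * (g - g') \<in> ideal_gen rels"
    by (intro ideal_gen.add ideal_gen.mult_left ideal_gen.mult_right)
  then show "f * g - f' * g' \<in> ideal_gen rels"
    by (simp add: algebra_simps)
qed

instance
proof
  show "(0::'a A) \<noteq> 1"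
  proof transfer
    show "0 - 1 \<notin> (ideal_gen rels :: (letter, 'a) tensor_alg set)"
      using lookup_ideal_Nil[of "0 - 1"]
      by (auto simp: lookup_minus lookup_one zero_list_def)
  qed
qed (transfer; simp add: ideal_gen.zero algebra_simps)+

end

lift_definition ascale :: "'k \<Rightarrow> 'k::field A \<Rightarrow> 'k A" is tscale
proof -
  fix c :: 'k and f g :: "(letter, 'k) tensor_alg"
  assume "f - g \<in> ideal_gen rels"
  then show "tscale c f - tscale c g \<in> ideal_gen rels"
    by (metis (no_types, lifting) ideal_gen.mult_left tscale_conv_mult tensor.scale_right_diff_distrib)
qed

interpretation A: vector_space "ascale :: 'k::field \<Rightarrow> 'k A \<Rightarrow> _"
  by unfold_locales
     (transfer; simp add: ideal_gen.zero tensor.scale_right_distrib tensor.scale_left_distrib)+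

definition xA :: "'k::field A" where "xA = proj_A (gen X)"
definition yA :: "'k::field A" where "yA = proj_A (gen Y)"


section \<open>Koszul homology of \<open>A\<close>\<close>

text \<open>As words are a basis of \<open>T(V)\<close>, the space \<open>A \<otimes> T(V)\<close> is that of finitely supported functions
  from words to \<open>A\<close>, with \<open>\<Sum>\<^sub>w a\<^sub>w \<otimes> w\<close> corresponding to \<open>w \<mapsto> a\<^sub>w\<close>.  Over a field, \<open>A \<otimes> W\<^sub>p\<close> is
  the subspace spanned by the tensors \<open>a \<otimes> f\<close> with \<open>f\<close> in \<open>W\<^sub>p\<close>.\<close>

type_synonym 'k chain = "letter list \<Rightarrow>\<^sub>0 'k A"

definition cscale :: "'k \<Rightarrow> 'k::field chain \<Rightarrow> 'k chain" where
  "cscale c z = Poly_Mapping.map (ascale c) z"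

lemma lookup_cscale [simp]:
  "Poly_Mapping.lookup (cscale c z) w = ascale c (Poly_Mapping.lookup z w)"
  by (simp add: cscale_def Poly_Mapping.map.rep_eq when_def)

interpretation chain: vector_space "cscale :: 'k::field \<Rightarrow> 'k chain \<Rightarrow> _"
  by unfold_locales
     (auto intro!: poly_mapping_eqI
       simp: lookup_add A.scale_right_distrib A.scale_left_distrib)

definition tensor_elem :: "'k::field A \<Rightarrow> (letter, 'k) tensor_alg \<Rightarrow> 'k chain"
    (infix "\<boxtimes>" 66) where
  "a \<boxtimes> f = Poly_Mapping.map (\<lambda>c. ascale c a) f"

definition chains :: "nat \<Rightarrow> 'k::field chain set" where
  "chains p = chain.span {a \<boxtimes> f | a f. f \<in> koszul_W rels p}"

text \<open>The formula for \<open>b\<^sub>K\<close> on a word \<open>x\<^sub>1\<dots>x\<^sub>p\<close>, extended linearly; the degree \<open>p\<close> is the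
  length of the word.\<close>

definition b_K :: "'k::field chain \<Rightarrow> 'k chain" where
  "b_K z = (\<Sum>w \<in> Poly_Mapping.keys z.
     if w = [] then 0
     else Poly_Mapping.single (tl w) (Poly_Mapping.lookup z w * proj_A (gen (hd w)))
        + Poly_Mapping.single (butlast w)
            ((- 1) ^ length w * (proj_A (gen (last w)) * Poly_Mapping.lookup z w)))"

definition cycles :: "nat \<Rightarrow> 'k::field chain set" where
  "cycles p = {z \<in> chains p. b_K z = 0}"

definition boundaries :: "nat \<Rightarrow> 'k::field chain set" where
  "boundaries p = b_K ` chains (Suc p)"

definition HK_class :: "nat \<Rightarrow> 'k::field chain \<Rightarrow> 'k chain set" where
  "HK_class p z = {z + b | b. b \<in> boundaries p}"

text \<open>The quotient space \<open>cycles p / boundaries p\<close>.  Adding the boundaries in the scalar product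
  is needed for the scalar \<open>0\<close> only.  The fields \<open>mult\<close> and \<open>one\<close> of the record are not used by
  modules.\<close>

definition HK :: "nat \<Rightarrow> ('k::field, 'k chain set) module" where
  "HK p = \<lparr> carrier = HK_class p ` cycles p,
            mult = undefined, one = undefined,
            zero = boundaries p,
            add = (\<lambda>S T. {s + t | s t. s \<in> S \<and> t \<in> T}),
            smult = (\<lambda>c S. {cscale c s + b | s b. s \<in> S \<and> b \<in> boundaries p}) \<rparr>"

definition HK_dim_generators :: "nat \<Rightarrow> nat \<Rightarrow> 'k::field chain set \<Rightarrow> bool" where
  "HK_dim_generators p n G \<longleftrightarrow>
     vectorspace class_ring (HK p :: ('k, 'k chain set) module) \<and>
     vectorspace.fin_dim class_ring (HK p :: ('k, 'k chain set) module) \<and>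
     vectorspace.dim class_ring (HK p :: ('k, 'k chain set) module) = n \<and>
     G \<subseteq> cycles p \<and>
     LinearCombinations.module.span class_ring (HK p) (HK_class p ` G) = carrier (HK p)"

end

theory Submission
  imports Defs
begin

text \<open>The algebra \<open>A\<close> is six-dimensional with basis \<open>1, x, y, xy, yx, xyx\<close>, and \<open>W\<^sub>p\<close> is spanned
  by \<open>x\<^sup>p\<close> for \<open>p \<ge> 3\<close>, since the conditions for \<open>V \<otimes> R\<close> and \<open>R \<otimes> V\<close> together exclude every
  word of length three other than \<open>xxx\<close> as a factor.  So the Koszul complex consists of spaces of
  dimensions \<open>6, 12, 12, 6, 6, \<dots>\<close>, its differentials are built from one-sided multiplications by
  \<open>x\<close> and \<open>y\<close>, and the homology is linear algebra in coordinates.  Characteristic zero is needed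
  only to divide by \<open>2\<close> and \<open>3\<close>.\<close>

section \<open>Tensors as functions on words\<close>

text \<open>The obstacle is equality in the quotient: rewriting can show that two elements of
  \<open>A\<close> agree, but not that they differ. So six linear functionals are shown to vanish on
  the ideal, hence to descend to \<open>A\<close>, and an induction on words shows that together
  they determine an element. An identity in \<open>A\<close> thereby becomes six scalar identities,
  and a cycle is reduced to the listed generators by exhibiting a preimage under the differential,
  found by solving those scalar equations. The divisor 2 comes from the anticommutator with x, which
  sends 1 to 2x. The divisor 3 is, up to sign, the determinant of the map sending b to by + yb - bx,
  from the span of x, y to the span of xy, yx: its matrix has rows (1, 2) and (1, -1). Inverting it
  produces boundaries in degree 1; its injectivity removes x and y from the second component of a
  2-cycle.\<close>

lemma lookup_times_word:
  fixes f g :: "'v list \<Rightarrow>\<^sub>0 'r::semiring_0"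
  shows "Poly_Mapping.lookup (f * g) w = (\<Sum>i\<le>length w. Poly_Mapping.lookup f (take i w) * Poly_Mapping.lookup g (drop i w))"
proof -
  \<comment> \<open>A factorisation of \<open>w\<close> is determined by the place of the cut, so
    the double sum over all words collapses to one over prefixes. For an explicit short word the
    simplifier can then evaluate a product completely.\<close>
  have inner: "Sum_any (\<lambda>q. Poly_Mapping.lookup g q when w = l + q)
      = (Poly_Mapping.lookup g (drop (length l) w) when take (length l) w = l)" for l
  proof (cases "take (length l) w = l")
    case True
    then have "w = l + q \<longleftrightarrow> q = drop (length l) w" for q
      by (metis append_eq_conv_conj append_take_drop_id plus_list_def)
    with True show ?thesis by simp
  next
    case False
    then have "w \<noteq> l + q" for q
      by (auto simp: plus_list_def)
    with False show ?thesis by simp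
  qed
  let ?P = "(\<lambda>i. take i w) ` {..length w}"
  have inj: "inj_on (\<lambda>i. take i w) {..length w}"
    by (rule inj_onI) (metis atMost_iff length_take min.absorb2)
  have "Poly_Mapping.lookup (f * g) w
      = Sum_any (\<lambda>l. Poly_Mapping.lookup f l * (Poly_Mapping.lookup g (drop (length l) w) when take (length l) w = l))"
    by (simp add: lookup_mult inner)
  also have "\<dots> = (\<Sum>l\<in>?P. Poly_Mapping.lookup f l * (Poly_Mapping.lookup g (drop (length l) w) when take (length l) w = l))"
  proof (rule Sum_any.expand_superset)
    show "{l. Poly_Mapping.lookup f l * (Poly_Mapping.lookup g (drop (length l) w) when take (length l) w = l) \<noteq> 0} \<subseteq> ?P"
    proof
      fix l assume "l \<in> {l. Poly_Mapping.lookup f l * (Poly_Mapping.lookup g (drop (length l) w) when take (length l) w = l) \<noteq> 0}"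
      then have "take (length l) w = l" by (auto simp: when_def split: if_splits)
      then show "l \<in> ?P" by (metis atMost_iff image_eqI length_take min.cobounded1)
    qed
  qed simp
  also have "\<dots> = (\<Sum>i\<le>length w. Poly_Mapping.lookup f (take i w) * Poly_Mapping.lookup g (drop i w))"
    by (subst sum.reindex[OF inj]) (auto intro!: sum.cong simp: min_def)
  finally show ?thesis .
qed

lemma tscale_mult_left: "tscale c f * g = tscale c (f * g)"
  by (simp add: tscale_conv_mult mult.assoc)

lemma tscale_mult_right: "f * tscale c g = tscale c (f * g)"
  by (rule poly_mapping_eqI) (simp add: lookup_times_word sum_distrib_left mult.left_commute)

lemma gen_power: "gen (v :: 'v) ^ n = Poly_Mapping.single (replicate n v) 1"
  by (induct n) (simp_all add: gen_def mult_single plus_list_def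
      flip: single_one[where ?'a = "'v list", unfolded zero_list_def])

lemma gen_times_gen: "gen u * gen v = Poly_Mapping.single [u, v] 1"
  by (simp add: gen_def mult_single plus_list_def)

lemma tpow_times: "f \<in> tpow m \<Longrightarrow> g \<in> tpow n \<Longrightarrow> f * g \<in> tpow (m + n)"
  unfolding tpow_def using keys_mult[of f g] by (fastforce simp: plus_list_def)

lemma single_in_tpow [simp]: "length w = n \<Longrightarrow> Poly_Mapping.single w c \<in> tpow n"
  by (auto simp: tpow_def split: if_splits)

lemma lookup_tpow_eq_0: "f \<in> tpow n \<Longrightarrow> length w \<noteq> n \<Longrightarrow> Poly_Mapping.lookup f w = 0"
  by (auto simp: tpow_def in_keys_iff)

lemma tpow_subspace: "tensor.subspace (tpow n :: ('v, 'k::field) tensor_alg set)"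
proof (rule tensor.subspaceI)
  fix f g :: "('v, 'k::field) tensor_alg" and c
  assume f: "f \<in> tpow n" and g: "g \<in> tpow n"
  show "f + g \<in> tpow n"
    using f g keys_add[of f g] by (auto simp: tpow_def)
  show "tscale c f \<in> tpow n"
    using f by (auto simp: tpow_def in_keys_iff)
qed (simp add: tpow_def)

lemma lookup_times_append:
  assumes "f \<in> tpow (length u)"
  shows "Poly_Mapping.lookup (f * g) (u @ v) = Poly_Mapping.lookup f u * Poly_Mapping.lookup g v"
proof -
  have "Poly_Mapping.lookup (f * g) (u @ v) = (\<Sum>i\<le>length (u @ v).
      if i = length u then Poly_Mapping.lookup f u * Poly_Mapping.lookup g v else 0)"
    unfolding lookup_times_word
    by (rule sum.cong) (auto simp: lookup_tpow_eq_0[OF assms])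
  then show ?thesis by simp
qed

section \<open>A basis of \<open>A\<close>\<close>

text \<open>The relations rewrite \<open>xx\<close> to \<open>0\<close>, \<open>yy\<close> to \<open>xy\<close> and hence \<open>yxy\<close> to \<open>0\<close>, so every word
  reduces to zero or to one of the normal words \<open>1, x, y, xy, yx, xyx\<close>.  The words with a given
  non-zero normal form are few, and summing over them gives the coordinates.\<close>

definition ideal_coords where
  "ideal_coords f \<longleftrightarrow> Poly_Mapping.lookup f [] = 0 \<and> Poly_Mapping.lookup f [X] = 0 \<and> Poly_Mapping.lookup f [Y] = 0
     \<and> Poly_Mapping.lookup f [X, Y] + Poly_Mapping.lookup f [Y, Y] = 0 \<and> Poly_Mapping.lookup f [Y, X] = 0
     \<and> Poly_Mapping.lookup f [X, Y, X] + Poly_Mapping.lookup f [Y, Y, X] = (0::'k::field)"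

text \<open>R is a plane in the four-dimensional space of quadratic tensors. These are the two
  linear equations it satisfies; they serve both for the ideal and for the spaces
  \<open>koszul_W\<close>.\<close>

lemma rels_lookup:
  assumes "f \<in> rels"
  shows "f \<in> tpow 2" "Poly_Mapping.lookup f [Y, X] = 0" "Poly_Mapping.lookup f [X, Y] + Poly_Mapping.lookup f [Y, Y] = 0"
proof -
  have "f \<in> tpow 2 \<and> Poly_Mapping.lookup f [Y, X] = 0 \<and> Poly_Mapping.lookup f [X, Y] + Poly_Mapping.lookup f [Y, Y] = 0"
    using assms unfolding rels_def
  proof (induct rule: tensor.span_induct_alt)
    case base
    then show ?case by (simp add: tensor.subspace_0[OF tpow_subspace])
  next
    case (step c x y)
    have "x \<in> tpow 2"
      using step(1) by (auto simp: gen_times_gen intro!: tensor.subspace_diff[OF tpow_subspace])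
    then have "tscale c x + y \<in> tpow 2"
      using step by (auto intro!: tensor.subspace_add tensor.subspace_scale tpow_subspace)
    moreover have "Poly_Mapping.lookup x [Y, X] = 0 \<and> Poly_Mapping.lookup x [X, Y] + Poly_Mapping.lookup x [Y, Y] = 0"
      using step(1) by (auto simp: gen_times_gen lookup_single lookup_minus)
    ultimately show ?case
      using step(2) by (auto simp: lookup_add add_eq_0_iff algebra_simps)
  qed
  then show "f \<in> tpow 2" "Poly_Mapping.lookup f [Y, X] = 0" "Poly_Mapping.lookup f [X, Y] + Poly_Mapping.lookup f [Y, Y] = 0"
    by auto
qed

text \<open>The conditions themselves define a two-sided ideal: wherever one of the words involved
  is cut, the factor falling to \<open>f\<close> is either a word on which \<open>f\<close> vanishes
  or one of a pair whose coefficients cancel.\<close>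

lemma ideal_coords_ideal: "f \<in> ideal_gen rels \<Longrightarrow> ideal_coords f"
proof (induct rule: ideal_gen.induct)
  case (incl r)
  then show ?case
    using rels_lookup[OF incl] lookup_tpow_eq_0[of r 2] by (simp add: ideal_coords_def)
next
  case (add f g)
  then show ?case
    by (auto simp: ideal_coords_def lookup_add add_eq_0_iff)
next
  case (mult_left f a)
  then have "Poly_Mapping.lookup f [X, Y] = - Poly_Mapping.lookup f [Y, Y]" "Poly_Mapping.lookup f [X, Y, X] = - Poly_Mapping.lookup f [Y, Y, X]"
    by (auto simp: ideal_coords_def eq_neg_iff_add_eq_0)
  with mult_left show ?case
    by (simp add: ideal_coords_def lookup_times_word numeral_eq_Suc)
next
  case (mult_right f a)
  then have "Poly_Mapping.lookup f [X, Y] = - Poly_Mapping.lookup f [Y, Y]" "Poly_Mapping.lookup f [X, Y, X] = - Poly_Mapping.lookup f [Y, Y, X]"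
    by (auto simp: ideal_coords_def eq_neg_iff_add_eq_0)
  with mult_right show ?case
    by (simp add: ideal_coords_def lookup_times_word numeral_eq_Suc)
qed (simp add: ideal_coords_def)

lift_definition c1 :: "'k::field A \<Rightarrow> 'k" is "\<lambda>f. Poly_Mapping.lookup f []"
  by (drule ideal_coords_ideal) (simp add: ideal_coords_def lookup_minus)
lift_definition cx :: "'k::field A \<Rightarrow> 'k" is "\<lambda>f. Poly_Mapping.lookup f [X]"
  by (drule ideal_coords_ideal) (simp add: ideal_coords_def lookup_minus)
lift_definition cy :: "'k::field A \<Rightarrow> 'k" is "\<lambda>f. Poly_Mapping.lookup f [Y]"
  by (drule ideal_coords_ideal) (simp add: ideal_coords_def lookup_minus)
lift_definition cxy :: "'k::field A \<Rightarrow> 'k" is "\<lambda>f. Poly_Mapping.lookup f [X, Y] + Poly_Mapping.lookup f [Y, Y]"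
  by (drule ideal_coords_ideal) (simp add: ideal_coords_def lookup_minus algebra_simps)
lift_definition cyx :: "'k::field A \<Rightarrow> 'k" is "\<lambda>f. Poly_Mapping.lookup f [Y, X]"
  by (drule ideal_coords_ideal) (simp add: ideal_coords_def lookup_minus)
lift_definition cxyx :: "'k::field A \<Rightarrow> 'k" is "\<lambda>f. Poly_Mapping.lookup f [X, Y, X] + Poly_Mapping.lookup f [Y, Y, X]"
  by (drule ideal_coords_ideal) (simp add: ideal_coords_def lookup_minus algebra_simps)

lemma coord_zero [simp]: "c1 0 = 0" "cx 0 = 0" "cy 0 = 0" "cxy 0 = 0" "cyx 0 = 0" "cxyx 0 = 0"
  by (transfer; simp)+

lemma coord_one [simp]: "c1 1 = 1" "cx 1 = 0" "cy 1 = 0" "cxy 1 = 0" "cyx 1 = 0" "cxyx 1 = 0"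
  by (transfer; simp add: lookup_one zero_list_def)+

lemma coord_add [simp]:
  "c1 (a + b) = c1 a + c1 b" "cx (a + b) = cx a + cx b" "cy (a + b) = cy a + cy b"
  "cxy (a + b) = cxy a + cxy b" "cyx (a + b) = cyx a + cyx b" "cxyx (a + b) = cxyx a + cxyx b"
  by (transfer; simp add: lookup_add)+

lemma coord_uminus [simp]:
  "c1 (- a) = - c1 a" "cx (- a) = - cx a" "cy (- a) = - cy a"
  "cxy (- a) = - cxy a" "cyx (- a) = - cyx a" "cxyx (- a) = - cxyx a"
  by (transfer; simp)+

lemma coord_diff [simp]:
  "c1 (a - b) = c1 a - c1 b" "cx (a - b) = cx a - cx b" "cy (a - b) = cy a - cy b"
  "cxy (a - b) = cxy a - cxy b" "cyx (a - b) = cyx a - cyx b" "cxyx (a - b) = cxyx a - cxyx b"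
  by (transfer; simp add: lookup_minus)+

lemma coord_ascale [simp]:
  "c1 (ascale c a) = c * c1 a" "cx (ascale c a) = c * cx a" "cy (ascale c a) = c * cy a"
  "cxy (ascale c a) = c * cxy a" "cyx (ascale c a) = c * cyx a" "cxyx (ascale c a) = c * cxyx a"
  by (transfer; simp add: algebra_simps)+

text \<open>The multiplication table of \<open>A\<close>, read off from the cuts of the normal
  words. The sums \<open>cx a + cy a\<close> reflect yy = xy and yyx = xyx.\<close>

lemma coord_times [simp]:
  "c1 (a * b) = c1 a * c1 b"
  "cx (a * b) = c1 a * cx b + cx a * c1 b"
  "cy (a * b) = c1 a * cy b + cy a * c1 b"
  "cxy (a * b) = c1 a * cxy b + (cx a + cy a) * cy b + cxy a * c1 b"
  "cyx (a * b) = c1 a * cyx b + cy a * cx b + cyx a * c1 b"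
  "cxyx (a * b) = c1 a * cxyx b + (cx a + cy a) * cyx b + cxy a * cx b + cxyx a * c1 b"
  by (transfer; simp add: lookup_times_word numeral_eq_Suc algebra_simps)+

lemma coord_xA [simp]:
  "c1 xA = 0" "cx xA = 1" "cy xA = 0" "cxy xA = 0" "cyx xA = 0" "cxyx xA = 0"
  unfolding xA_def by (transfer; simp add: gen_def lookup_single)+

lemma coord_yA [simp]:
  "c1 yA = 0" "cx yA = 0" "cy yA = 1" "cxy yA = 0" "cyx yA = 0" "cxyx yA = 0"
  unfolding yA_def by (transfer; simp add: gen_def lookup_single)+

section \<open>The normal words span the algebra\<close>

definition mkA :: "'k \<Rightarrow> 'k \<Rightarrow> 'k \<Rightarrow> 'k \<Rightarrow> 'k \<Rightarrow> 'k \<Rightarrow> 'k::field A" where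
  "mkA a b c d e f = ascale a 1 + ascale b xA + ascale c yA + ascale d (xA * yA)
     + ascale e (yA * xA) + ascale f (xA * yA * xA)"

lemma coord_mkA [simp]:
  "c1 (mkA a b c d e f) = a" "cx (mkA a b c d e f) = b" "cy (mkA a b c d e f) = c"
  "cxy (mkA a b c d e f) = d" "cyx (mkA a b c d e f) = e" "cxyx (mkA a b c d e f) = f"
  by (simp_all add: mkA_def)

lemma ascale_mult_left: "ascale c a * b = ascale c (a * b)"
  by transfer (simp add: tscale_mult_left ideal_gen.zero)

lemma ascale_mult_right: "a * ascale c b = ascale c (a * b)"
  by transfer (simp add: tscale_mult_right ideal_gen.zero)

lemma proj_A_eq: "proj_A f = proj_A g \<longleftrightarrow> f - g \<in> ideal_gen rels"
  by (rule A.abs_eq_iff)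

lemma proj_A_times: "proj_A (f * g) = proj_A f * proj_A g"
  by (simp add: times_A.abs_eq)

lemma xA_xA: "xA * xA = (0 :: 'k::field A)"
proof -
  have "gen X * gen X \<in> (rels :: (letter, 'k) tensor_alg set)"
    unfolding rels_def by (rule tensor.span_base) simp
  then show ?thesis
    unfolding xA_def proj_A_times[symmetric] zero_A_def proj_A_eq by (simp add: ideal_gen.incl)
qed

lemma yA_yA: "yA * yA = (xA * yA :: 'k::field A)"
proof -
  have "gen Y * gen Y - gen X * gen Y \<in> (rels :: (letter, 'k) tensor_alg set)"
    unfolding rels_def by (rule tensor.span_base) simp
  then show ?thesis
    unfolding xA_def yA_def proj_A_times[symmetric] proj_A_eq by (simp add: ideal_gen.incl)
qed

text \<open>This resolves the overlap yyy: bracketed one way it is yxy, the other way xyy = xxy =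
  0.\<close>

lemma yA_xA_yA: "yA * xA * yA = 0"
proof -
  have "yA * xA * yA = yA * (yA * yA)"
    by (simp add: yA_yA mult.assoc)
  also have "\<dots> = (yA * yA) * yA"
    by (rule mult.assoc[symmetric])
  also have "\<dots> = xA * (yA * yA)"
    by (simp only: yA_yA mult.assoc)
  also have "\<dots> = (xA * xA) * yA"
    by (simp only: yA_yA mult.assoc)
  finally show ?thesis
    by (simp add: xA_xA)
qed

lemma normal_form: "mkA (c1 a) (cx a) (cy a) (cxy a) (cyx a) (cxyx a) = a" (is "?N a = a")
proof (induct a rule: A.abs_induct)
  case (1 f)
  have N_add: "?N (a + b) = a + b" if "?N a = a" "?N b = b" for a b
  proof -
    have "?N (a + b) = ?N a + ?N b"
      by (simp add: mkA_def A.scale_left_distrib algebra_simps)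
    with that show ?thesis by simp
  qed
  \<comment> \<open>The elements equal to their normal form are closed under addition and under left
    multiplication by both generators, and they contain the scalars. Building words from the right
    end then reaches every element.\<close>
  have x: "?N (xA * a) = xA * a" if "?N a = a" for a
  proof -
    have "xA * a = xA * ?N a" using that by simp
    also have "\<dots> = ?N (xA * a)"
      by (simp add: mkA_def distrib_left ascale_mult_right xA_xA flip: mult.assoc)
    finally show ?thesis by (rule sym)
  qed
  have y: "?N (yA * a) = yA * a" if "?N a = a" for a
  proof -
    have "yA * a = yA * ?N a" using that by simp
    also have "\<dots> = ?N (yA * a)"
      by (simp add: mkA_def distrib_left ascale_mult_right yA_yA yA_xA_yA xA_xA A.scale_left_distrib
          add.assoc add.commute add.left_commute flip: mult.assoc)
    finally show ?thesis by (rule sym)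
  qed
  have s: "?N (proj_A (Poly_Mapping.single w c)) = proj_A (Poly_Mapping.single w c)" for w c
  proof (induct w)
    case Nil
    have "proj_A (Poly_Mapping.single [] c) = ascale c 1"
      by (simp add: ascale.abs_eq one_A_def tscale_conv_mult)
    then show ?case by (simp add: mkA_def)
  next
    case (Cons v w)
    have "proj_A (Poly_Mapping.single (v # w) c) = proj_A (gen v) * proj_A (Poly_Mapping.single w c)"
      by (simp add: gen_def mult_single plus_list_def flip: proj_A_times)
    then show ?case
      using x[OF Cons] y[OF Cons] by (cases v) (simp_all add: xA_def yA_def)
  qed
  show ?case
  proof (induct f rule: update_induct)
    case const
    then show ?case by (simp add: mkA_def flip: zero_A_def)
  next
    case (update f a b)
    have "Poly_Mapping.update a b f = f + Poly_Mapping.single a b"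
      using update by (intro poly_mapping_eqI)
        (auto simp: lookup_update lookup_add lookup_single in_keys_iff)
    then show ?case
      using N_add[OF update(3) s] by (simp add: plus_A.abs_eq)
  qed
qed

text \<open>The device behind all later computations: with \<open>coord_times\<close> it turns an
  equation in \<open>A\<close> into a linear system over the field.\<close>

lemma A_eq_iff: "a = b \<longleftrightarrow> c1 a = c1 b \<and> cx a = cx b \<and> cy a = cy b
   \<and> cxy a = cxy b \<and> cyx a = cyx b \<and> cxyx a = cxyx b"
  (is "_ \<longleftrightarrow> ?R")
proof
  assume R: ?R
  have "a = mkA (c1 a) (cx a) (cy a) (cxy a) (cyx a) (cxyx a)"
    by (rule normal_form[symmetric])
  also have "\<dots> = mkA (c1 b) (cx b) (cy b) (cxy b) (cyx b) (cxyx b)"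
    using R by (simp only:)
  also have "\<dots> = b"
    by (rule normal_form)
  finally show "a = b" .
qed simp

section \<open>The quotient of the cycles by the boundaries\<close>

lemma b_K_single:
  "b_K (Poly_Mapping.single w a) = (if w = [] then 0
     else Poly_Mapping.single (tl w) (a * proj_A (gen (hd w)))
        + Poly_Mapping.single (butlast w) ((- 1) ^ length w * (proj_A (gen (last w)) * a)))"
  by (simp add: b_K_def)

text \<open>The definition of \<open>b_K\<close> sums over the support, which changes under addition
  and scaling. Zero coefficients contribute nothing, so a common larger index set may be used, and
  linearity can be checked word by word.\<close>

lemma b_K_sum:
  assumes "finite S" "Poly_Mapping.keys z \<subseteq> S"
  shows "b_K z = (\<Sum>w\<in>S. b_K (Poly_Mapping.single w (Poly_Mapping.lookup z w)))"
  unfolding b_K_single using assms unfolding b_K_def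
  by (intro sum.mono_neutral_left) (auto simp: in_keys_iff)

lemma b_K_add: "b_K (y + z) = b_K y + b_K z"
proof -
  let ?S = "Poly_Mapping.keys y \<union> Poly_Mapping.keys z"
  have add: "b_K (Poly_Mapping.single w (a + b)) = b_K (Poly_Mapping.single w a) + b_K (Poly_Mapping.single w b)"
    for w and a b :: "'a A"
    unfolding b_K_single by (simp add: single_add algebra_simps)
  have "b_K (y + z) = (\<Sum>w\<in>?S. b_K (Poly_Mapping.single w (Poly_Mapping.lookup (y + z) w)))"
    by (rule b_K_sum) (simp_all add: keys_add)
  also have "\<dots> = b_K y + b_K z"
    by (simp add: lookup_add add sum.distrib b_K_sum[of ?S y] b_K_sum[of ?S z])
  finally show ?thesis .
qed

lemma cscale_single: "cscale c (Poly_Mapping.single w a) = Poly_Mapping.single w (ascale c a)"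
  by (rule poly_mapping_eqI) (simp add: lookup_single when_def)

lemma b_K_cscale: "b_K (cscale c z) = cscale c (b_K z)"
proof -
  have scale: "b_K (Poly_Mapping.single w (ascale c a)) = cscale c (b_K (Poly_Mapping.single w a))" for w a
    by (simp add: b_K_single ascale_mult_left ascale_mult_right cscale_single chain.scale_right_distrib)
  have "b_K (cscale c z) = (\<Sum>w\<in>Poly_Mapping.keys z. b_K (Poly_Mapping.single w (Poly_Mapping.lookup (cscale c z) w)))"
    by (rule b_K_sum) (auto simp: in_keys_iff)
  also have "\<dots> = cscale c (b_K z)"
    by (simp add: scale chain.scale_sum_right b_K_sum[of "Poly_Mapping.keys z" z])
  finally show ?thesis .
qed

lemma linear_b_K: "Vector_Spaces.linear cscale cscale b_K"
  by unfold_locales (simp_all add: b_K_add b_K_cscale)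

lemma subspace_chains: "chain.subspace (chains p)"
  unfolding chains_def by (rule chain.subspace_span)

lemma subspace_boundaries: "chain.subspace (boundaries p :: 'k::field chain set)"
proof -
  interpret b_K: Vector_Spaces.linear cscale cscale "b_K :: 'k chain \<Rightarrow> 'k chain"
    by (rule linear_b_K)
  show ?thesis
    unfolding boundaries_def by (rule b_K.subspace_image[OF subspace_chains])
qed

lemma subspace_cycles: "chain.subspace (cycles p :: 'k::field chain set)"
proof (rule chain.subspaceI)
  show "0 \<in> (cycles p :: 'k chain set)"
    by (simp add: cycles_def b_K_def chain.subspace_0[OF subspace_chains])
qed (auto simp: cycles_def b_K_add b_K_cscale intro: chain.subspace_add[OF subspace_chains]
      chain.subspace_scale[OF subspace_chains])

section \<open>Cosets of boundaries as a vector space\<close>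

lemma HK_class_self: "z \<in> HK_class p z"
  using chain.subspace_0[OF subspace_boundaries[of p]] by (force simp: HK_class_def)

lemma HK_class_eq_iff: "HK_class p y = HK_class p z \<longleftrightarrow> y - z \<in> boundaries p"
proof
  assume "HK_class p y = HK_class p z"
  then have "y \<in> HK_class p z"
    using HK_class_self by blast
  then show "y - z \<in> boundaries p"
    by (auto simp: HK_class_def)
next
  assume d: "y - z \<in> boundaries p"
  have "y + b \<in> HK_class p z \<and> z + b \<in> HK_class p y" if b: "b \<in> boundaries p" for b
  proof
    have "y + b = z + ((y - z) + b)" by simp
    then show "y + b \<in> HK_class p z"
      using chain.subspace_add[OF subspace_boundaries d b] unfolding HK_class_def by blast
    have "z + b = y + (b - (y - z))" by simp
    then show "z + b \<in> HK_class p y"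
      using chain.subspace_diff[OF subspace_boundaries b d] unfolding HK_class_def by blast
  qed
  then show "HK_class p y = HK_class p z"
    unfolding HK_class_def by blast
qed

lemma HK_class_0: "HK_class p 0 = boundaries p"
  by (simp add: HK_class_def)

lemma HK_add: "add (HK p) (HK_class p y) (HK_class p z) = HK_class p (y + z)"
proof (intro Set.set_eqI iffI)
  fix u assume "u \<in> add (HK p) (HK_class p y) (HK_class p z)"
  then obtain b c where "b \<in> boundaries p" "c \<in> boundaries p" "u = (y + b) + (z + c)"
    by (auto simp: HK_def HK_class_def)
  then have "u = (y + z) + (b + c)" "b + c \<in> boundaries p"
    using chain.subspace_add[OF subspace_boundaries] by (simp_all add: algebra_simps)
  then show "u \<in> HK_class p (y + z)"
    unfolding HK_class_def by blast
next
  fix u assume "u \<in> HK_class p (y + z)"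
  then obtain b where "b \<in> boundaries p" "u = (y + b) + z"
    by (auto simp: HK_class_def algebra_simps)
  then have "\<exists>s t. u = s + t \<and> s \<in> HK_class p y \<and> t \<in> HK_class p z"
    using HK_class_self[of z p] unfolding HK_class_def[of p y] by blast
  then show "u \<in> add (HK p) (HK_class p y) (HK_class p z)"
    by (simp add: HK_def)
qed

lemma HK_smult: "smult (HK p) c (HK_class p z) = HK_class p (cscale c z)"
proof (intro Set.set_eqI iffI)
  fix u assume "u \<in> smult (HK p) c (HK_class p z)"
  then obtain b d where "b \<in> boundaries p" "d \<in> boundaries p" "u = cscale c (z + b) + d"
    by (auto simp: HK_def HK_class_def)
  then have "u = cscale c z + (cscale c b + d)" "cscale c b + d \<in> boundaries p"
    by (simp_all add: chain.scale_right_distrib chain.subspace_add[OF subspace_boundaries]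
        chain.subspace_scale[OF subspace_boundaries])
  then show "u \<in> HK_class p (cscale c z)"
    unfolding HK_class_def by blast
next
  fix u assume "u \<in> HK_class p (cscale c z)"
  then have "\<exists>s b. u = cscale c s + b \<and> s \<in> HK_class p z \<and> b \<in> boundaries p"
    using HK_class_self[of z p] unfolding HK_class_def[of p "cscale c z"] by blast
  then show "u \<in> smult (HK p) c (HK_class p z)"
    by (simp add: HK_def)
qed

lemma HK_carrier: "carrier (HK p) = HK_class p ` cycles p"
  and HK_zero: "zero (HK p) = HK_class p 0"
  by (simp_all add: HK_def HK_class_0)

lemma HK_vectorspace: "vectorspace class_ring (HK p :: ('k::field, 'k chain set) module)"
proof -
  note Z = subspace_cycles[of p]
  have "abelian_group (HK p :: ('k, 'k chain set) module)"
  proof (rule abelian_groupI)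
    fix x assume "x \<in> carrier (HK p :: ('k, 'k chain set) module)"
    then obtain z where z: "z \<in> cycles p" "x = HK_class p z"
      by (auto simp: HK_carrier)
    then have "HK_class p (- z) \<in> carrier (HK p)" "HK_class p (- z) \<oplus>\<^bsub>HK p\<^esub> x = \<zero>\<^bsub>HK p\<^esub>"
      by (auto simp: HK_carrier HK_add HK_zero chain.subspace_neg[OF Z])
    then show "\<exists>y\<in>carrier (HK p). y \<oplus>\<^bsub>HK p\<^esub> x = \<zero>\<^bsub>HK p\<^esub>" ..
  qed (auto simp: HK_carrier HK_add HK_zero chain.subspace_0[OF Z] add_ac
        intro!: imageI chain.subspace_add[OF Z])
  then have "Module.module class_ring (HK p :: ('k, 'k chain set) module)"
    by (intro moduleI class_cring.is_cring)
      (auto simp: HK_carrier HK_add HK_smult chain.scale_left_distrib chain.scale_right_distrib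
        intro!: imageI chain.subspace_scale[OF Z])
  then show ?thesis
    by (intro vectorspace.intro class_field)
qed

lemma HK_finsum:
  fixes f :: "'i \<Rightarrow> 'k::field chain"
  assumes "finite I" "f ` I \<subseteq> cycles p"
  shows "finsum (HK p :: ('k, 'k chain set) module) (\<lambda>i. HK_class p (f i)) I
    = HK_class p (\<Sum>i\<in>I. f i)"
proof -
  interpret HK: vectorspace class_ring "HK p :: ('k, 'k chain set) module"
    by (rule HK_vectorspace)
  show ?thesis
    using assms
  proof (induct I rule: finite_induct)
    case empty
    then show ?case by (simp add: HK_zero)
  next
    case (insert i I)
    have "finsum (HK p) (\<lambda>i. HK_class p (f i)) (insert i I)
        = HK_class p (f i) \<oplus>\<^bsub>HK p\<^esub> finsum (HK p) (\<lambda>i. HK_class p (f i)) I"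
      using insert(1,2,4) by (intro HK.finsum_insert) (auto simp: HK_carrier)
    also have "\<dots> = HK_class p (f i) \<oplus>\<^bsub>HK p\<^esub> HK_class p (\<Sum>i\<in>I. f i)"
      using insert(3,4) by simp
    finally show ?case
      using insert(1,2) by (simp add: HK_add)
  qed
qed

text \<open>This replaces cosets by calculations with representatives. Coefficients are indexed by
  positions in a list, so independence modulo boundaries also forces the classes to be distinct, and
  the dimension is the length of the list.\<close>

lemma HK_dim_generatorsI:
  fixes gs :: "'k::field chain list"
  assumes cyc: "set gs \<subseteq> cycles p"
    and gen: "\<And>z. z \<in> cycles p \<Longrightarrow>
      \<exists>c. z - (\<Sum>i<length gs. cscale (c i) (gs ! i)) \<in> boundaries p"
    and indep: "\<And>c i. (\<Sum>i<length gs. cscale (c i) (gs ! i)) \<in> boundaries p \<Longrightarrow>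
      i < length gs \<Longrightarrow> c i = 0"
  shows "HK_dim_generators p (length gs) (set gs)"
proof -
  let ?V = "HK p :: ('k, 'k chain set) module"
  interpret HK: vectorspace class_ring ?V
    by (rule HK_vectorspace)
  let ?n = "length gs"
  let ?h = "\<lambda>i. HK_class p (gs ! i)"
  let ?H = "?h ` {..<?n}"
  have H: "HK_class p ` set gs = ?H"
    by (auto simp: set_conv_nth)
  have gs: "gs ! i \<in> cycles p" if "i < ?n" for i
    using cyc that by auto
  have inj: "inj_on ?h {..<?n}"
  proof (rule inj_onI, rule ccontr)
    fix i j assume ij: "i \<in> {..<?n}" "j \<in> {..<?n}" "?h i = ?h j" "i \<noteq> j"
    \<comment> \<open>Two equal classes would give the nontrivial relation with coefficient 1 at
      \<open>i\<close> and -1 at \<open>j\<close>.\<close>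
    let ?c = "\<lambda>l. (if l = i then 1 else 0) - (if l = j then 1 else 0) :: 'k"
    have "(\<Sum>l<?n. cscale (?c l) (gs ! l)) = gs ! i - gs ! j"
      using ij by (simp add: chain.scale_left_diff_distrib sum_subtractf if_distrib[where f = "\<lambda>c. cscale c _"] cong: if_cong)
    with ij have "?c i = 0"
      by (intro indep[of ?c i]) (auto simp: HK_class_eq_iff)
    with ij show False
      by simp
  qed
  have H_carrier: "?H \<subseteq> carrier ?V"
    by (auto simp: HK_carrier gs)
  have lincomb: "HK.lincomb a ?H = HK_class p (\<Sum>i<?n. cscale (a (?h i)) (gs ! i))" for a
  proof -
    have "HK.lincomb a ?H = finsum ?V (\<lambda>i. a (?h i) \<odot>\<^bsub>?V\<^esub> ?h i) {..<?n}"
      unfolding HK.lincomb_def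
      by (rule HK.finsum_reindex[OF _ inj])
        (auto simp: HK_smult HK_carrier intro!: imageI chain.subspace_scale[OF subspace_cycles] gs)
    also have "\<dots> = HK_class p (\<Sum>i<?n. cscale (a (?h i)) (gs ! i))"
      unfolding HK_smult
      by (rule HK_finsum) (auto intro!: chain.subspace_scale[OF subspace_cycles] gs)
    finally show ?thesis .
  qed
  have "carrier ?V \<subseteq> HK.span ?H"
  proof
    fix x assume "x \<in> carrier ?V"
    then obtain z where z: "z \<in> cycles p" "x = HK_class p z"
      by (auto simp: HK_carrier)
    from gen[OF z(1)] obtain c where c: "z - (\<Sum>i<?n. cscale (c i) (gs ! i)) \<in> boundaries p" ..
    \<comment> \<open>\<open>lincomb\<close> expects coefficients indexed by vectors, so those
      indexed by positions are transported along the injection \<open>?h\<close>.\<close>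
    define a where "a v = c (the_inv_into {..<?n} ?h v)" for v
    have "a (?h i) = c i" if "i < ?n" for i
      using that by (simp add: a_def the_inv_into_f_f[OF inj])
    then have "(\<Sum>i<?n. cscale (a (?h i)) (gs ! i)) = (\<Sum>i<?n. cscale (c i) (gs ! i))"
      by (intro sum.cong) auto
    with c have "x = HK.lincomb a ?H"
      unfolding lincomb z HK_class_eq_iff by simp
    then show "x \<in> HK.span ?H"
      unfolding HK.span_def by auto
  qed
  then have span: "HK.span ?H = carrier ?V"
    using HK.span_is_subset2[OF H_carrier] by auto
  have "HK.lin_indpt ?H"
  proof (rule HK.finite_lin_indpt2[OF _ H_carrier])
    fix a assume "HK.lincomb a ?H = \<zero>\<^bsub>?V\<^esub>"
    then have "(\<Sum>i<?n. cscale (a (?h i)) (gs ! i)) \<in> boundaries p"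
      by (simp add: lincomb HK_zero HK_class_eq_iff)
    then have "a (?h i) = 0" if "i < ?n" for i
      using indep[of "\<lambda>i. a (?h i)"] that by blast
    then show "\<forall>v\<in>?H. a v = \<zero>\<^bsub>class_ring\<^esub>"
      by auto
  qed simp
  then have "HK.basis ?H"
    using H_carrier span by (simp add: HK.basis_def)
  then have "HK.dim = ?n"
    using HK.dim_basis[of ?H] by (simp add: card_image[OF inj])
  moreover have "HK.fin_dim"
    unfolding HK.fin_dim_def using H_carrier span by blast
  ultimately show ?thesis
    unfolding HK_dim_generators_def H using HK_vectorspace cyc span by blast
qed

section \<open>The spaces \<open>W\<^sub>p\<close> and the Koszul complex\<close>

lemma tpow_0: "tpow 0 = tensor.span {1 :: ('v, 'k::field) tensor_alg}"
proof
  show "tpow 0 \<subseteq> tensor.span {1 :: ('v, 'k) tensor_alg}"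
  proof
    fix f :: "('v, 'k) tensor_alg" assume f: "f \<in> tpow 0"
    have "f = tscale (Poly_Mapping.lookup f []) 1"
      by (rule poly_mapping_eqI)
        (auto simp: lookup_one zero_list_def when_def lookup_tpow_eq_0[OF f])
    also have "\<dots> \<in> tensor.span {1}"
      by (intro tensor.span_scale tensor.span_base) simp
    finally show "f \<in> tensor.span {1}" .
  qed
  show "tensor.span {1 :: ('v, 'k) tensor_alg} \<subseteq> tpow 0"
    by (intro tensor.span_minimal tpow_subspace) (simp add: tpow_def zero_list_def)
qed

lemma tpow_1: "tpow 1 = tensor.span {gen X, gen Y :: (letter, 'k::field) tensor_alg}"
proof
  show "tpow 1 \<subseteq> tensor.span {gen X, gen Y :: (letter, 'k) tensor_alg}"
  proof
    fix f :: "(letter, 'k) tensor_alg" assume f: "f \<in> tpow 1"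
    have "f = tscale (Poly_Mapping.lookup f [X]) (gen X) + tscale (Poly_Mapping.lookup f [Y]) (gen Y)"
    proof (rule poly_mapping_eqI)
      fix w
      consider "w = [X]" | "w = [Y]" | "length w \<noteq> 1"
        by (cases w; cases "hd w") auto
      then show "Poly_Mapping.lookup f w = Poly_Mapping.lookup (tscale (Poly_Mapping.lookup f [X]) (gen X)
          + tscale (Poly_Mapping.lookup f [Y]) (gen Y)) w"
        by cases (auto simp: gen_def lookup_add lookup_single when_def lookup_tpow_eq_0[OF f])
    qed
    also have "\<dots> \<in> tensor.span {gen X, gen Y}"
      by (intro tensor.span_add tensor.span_scale tensor.span_base) simp_all
    finally show "f \<in> tensor.span {gen X, gen Y}" .
  qed
  show "tensor.span {gen X, gen Y :: (letter, 'k) tensor_alg} \<subseteq> tpow 1"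
    by (intro tensor.span_minimal tpow_subspace) (simp add: gen_def)
qed

lemma koszul_W_0: "koszul_W rels 0 = tensor.span {1}"
  by (simp add: koszul_W_def tpow_0)

lemma koszul_W_1: "koszul_W rels 1 = tensor.span {gen X, gen Y}"
  by (simp add: koszul_W_def flip: tpow_1)

text \<open>Only i = j = 0 occurs in the intersection, and then the outer factors are scalars, so
  this space is R itself.\<close>

lemma koszul_W_2:
  "koszul_W rels 2 = tensor.span {gen X ^ 2, gen Y ^ 2 - gen X * gen Y :: (letter, 'k::field) tensor_alg}"
proof -
  let ?S = "{u * r * v | u r v. u \<in> tpow 0 \<and> r \<in> rels \<and> v \<in> tpow 0} :: (letter, 'k) tensor_alg set"
  have "tensor.span ?S = rels"
  proof
    have "u * r * v \<in> rels" if uv: "u \<in> tpow 0" "v \<in> tpow 0" and r: "r \<in> rels"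
      for u r v :: "(letter, 'k) tensor_alg"
    proof -
      from uv obtain c d where "u = tscale c 1" "v = tscale d 1"
        by (auto simp: tpow_0 tensor.span_singleton)
      then have "u * r * v = tscale d (tscale c r)"
        by (simp add: tscale_mult_left tscale_mult_right)
      with r show ?thesis
        unfolding rels_def by (simp add: tensor.span_scale)
    qed
    then show "tensor.span ?S \<subseteq> rels"
      by (intro tensor.span_minimal) (auto simp: rels_def tensor.subspace_span)
    have "r \<in> ?S" if "r \<in> rels" for r
    proof -
      have "1 \<in> (tpow 0 :: (letter, 'k) tensor_alg set)" "r = 1 * r * 1"
        by (simp_all add: tpow_0 tensor.span_base)
      with that show ?thesis by blast
    qed
    then show "rels \<subseteq> tensor.span ?S"
      by (meson subsetI tensor.span_base)
  qed
  moreover have "{(i, j). i + 2 + j = (2::nat)} = {(0, 0)}"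
    by auto
  ultimately have "koszul_W rels 2 = (rels :: (letter, 'k) tensor_alg set)"
    by (simp add: koszul_W_def)
  then show ?thesis
    by (simp add: rels_def power2_eq_square)
qed

text \<open>Coefficients of a product of homogeneous tensors are products of coefficients, so the
  two equations of R hold at the letters in positions i and i + 1, whatever surrounds them.\<close>

lemma span_tpow_rels_tpow_lookup:
  assumes "f \<in> tensor.span {u * r * v | u r v. u \<in> tpow i \<and> r \<in> rels \<and> v \<in> tpow j}"
  shows "f \<in> tpow (i + 2 + j)"
    and "length u = i \<Longrightarrow> Poly_Mapping.lookup f (u @ Y # X # v) = 0"
    and "length u = i \<Longrightarrow>
      Poly_Mapping.lookup f (u @ X # Y # v) = - Poly_Mapping.lookup f (u @ Y # Y # v)"
proof -
  let ?Q = "{f. f \<in> tpow (i + 2 + j) \<and> (\<forall>u v. length u = i \<longrightarrow>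
      Poly_Mapping.lookup f (u @ Y # X # v) = 0 \<and>
      Poly_Mapping.lookup f (u @ X # Y # v) = - Poly_Mapping.lookup f (u @ Y # Y # v))}"
  have "u0 * r * v0 \<in> ?Q" if u0: "u0 \<in> tpow i" and r: "r \<in> rels" and v0: "v0 \<in> tpow j" for u0 r v0
  proof -
    have u0r: "u0 * r \<in> tpow (i + 2)"
      by (intro tpow_times u0 rels_lookup r)
    have "Poly_Mapping.lookup (u0 * r * v0) (u @ a # b # v)
        = Poly_Mapping.lookup u0 u * Poly_Mapping.lookup r [a, b] * Poly_Mapping.lookup v0 v"
      if "length u = i" for u v a b
      using lookup_times_append[of "u0 * r" "u @ [a, b]" v0 v] lookup_times_append[of u0 u r "[a, b]"]
        u0 u0r that by simp
    moreover have "Poly_Mapping.lookup r [X, Y] = - Poly_Mapping.lookup r [Y, Y]"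
      using rels_lookup(3)[OF r] by (simp add: eq_neg_iff_add_eq_0)
    ultimately show ?thesis
      using tpow_times[OF u0r v0] rels_lookup(2)[OF r] by simp
  qed
  moreover have "tensor.subspace ?Q"
    by (rule tensor.subspaceI)
      (auto simp: lookup_add tensor.subspace_0 tensor.subspace_add tensor.subspace_scale tpow_subspace)
  ultimately have "tensor.span {u * r * v | u r v. u \<in> tpow i \<and> r \<in> rels \<and> v \<in> tpow j} \<subseteq> ?Q"
    by (intro tensor.span_minimal) auto
  with assms have "f \<in> ?Q" by blast
  then show "f \<in> tpow (i + 2 + j)"
    and "length u = i \<Longrightarrow> Poly_Mapping.lookup f (u @ Y # X # v) = 0"
    and "length u = i \<Longrightarrow>
      Poly_Mapping.lookup f (u @ X # Y # v) = - Poly_Mapping.lookup f (u @ Y # Y # v)"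
    by auto
qed

lemma koszul_W_ge_3:
  assumes p: "3 \<le> p"
  shows "koszul_W rels p = tensor.span {gen X ^ p :: (letter, 'k::field) tensor_alg}"
proof
  let ?S = "\<lambda>i j. tensor.span {u * r * v | u r v. u \<in> tpow i \<and> r \<in> rels \<and> v \<in> tpow j}
    :: (letter, 'k) tensor_alg set"
  have W: "koszul_W rels p = \<Inter>{?S i j | i j. i + 2 + j = p}"
    using p by (simp add: koszul_W_def)
  have "(gen X ^ p :: (letter, 'k) tensor_alg) \<in> ?S i j" if "i + 2 + j = p" for i j
  proof -
    have "(gen X ^ p :: (letter, 'k) tensor_alg) = gen X ^ i * (gen X * gen X) * gen X ^ j"
      unfolding that[symmetric] power_add power2_eq_square ..
    moreover have "gen X * gen X \<in> (rels :: (letter, 'k) tensor_alg set)"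
      unfolding rels_def by (rule tensor.span_base) simp
    moreover have "(gen X ^ n :: (letter, 'k) tensor_alg) \<in> tpow n" for n
      by (simp add: gen_power)
    ultimately show ?thesis
      by (intro tensor.span_base) blast
  qed
  then show "tensor.span {gen X ^ p :: (letter, 'k) tensor_alg} \<subseteq> koszul_W rels p"
    unfolding W by (intro tensor.span_minimal tensor.subspace_Inter) (auto simp: tensor.subspace_span)
  show "koszul_W rels p \<subseteq> tensor.span {gen X ^ p :: (letter, 'k) tensor_alg}"
  proof
    fix f :: "(letter, 'k) tensor_alg" assume "f \<in> koszul_W rels p"
    then have f: "f \<in> ?S i j" if "i + 2 + j = p" for i j
      unfolding W using that by blast
    have tp: "f \<in> tpow p"
      using span_tpow_rels_tpow_lookup(1)[OF f[of 0 "p - 2"]] p by simp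
    have YX: "Poly_Mapping.lookup f (u @ Y # X # v) = 0" if "length u + 2 + length v = p" for u v
      using span_tpow_rels_tpow_lookup(2)[OF f[OF that]] by simp
    have XY: "Poly_Mapping.lookup f (u @ X # Y # v) = - Poly_Mapping.lookup f (u @ Y # Y # v)"
      if "length u + 2 + length v = p" for u v
      using span_tpow_rels_tpow_lookup(3)[OF f[OF that]] by simp
    \<comment> \<open>The vanishing at yx kills every window containing yx. The sign relation,
      applied at either of the two places in the window, then carries zero from yxy to yyy, from
      there to xyy, and from there to xxy.\<close>
    have zero: "Poly_Mapping.lookup f (u @ a # b # c # v) = 0"
      if len: "length u + 3 + length v = p" and Y: "a = Y \<or> b = Y \<or> c = Y" for u a b c v
    proof -
      have "Poly_Mapping.lookup f (u @ Y # X # c # v) = 0" "Poly_Mapping.lookup f (u @ a # Y # X # v) = 0" for a c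
        using YX[of u "c # v"] YX[of "u @ [a]" v] len by simp_all
      moreover from this have "Poly_Mapping.lookup f (u @ Y # Y # Y # v) = 0"
        using XY[of "u @ [Y]" v] len by simp
      moreover from this have "Poly_Mapping.lookup f (u @ X # Y # Y # v) = 0"
        using XY[of u "Y # v"] len by simp
      moreover from this have "Poly_Mapping.lookup f (u @ X # X # Y # v) = 0"
        using XY[of "u @ [X]" v] len by simp
      ultimately show ?thesis
        using Y by (cases a; cases b; cases c) simp_all
    qed
    have "f = tscale (Poly_Mapping.lookup f (replicate p X)) (gen X ^ p)"
    proof (rule poly_mapping_eqI)
      fix w
      show "Poly_Mapping.lookup f w
          = Poly_Mapping.lookup (tscale (Poly_Mapping.lookup f (replicate p X)) (gen X ^ p)) w"
      proof (cases "length w = p \<and> w \<noteq> replicate p X")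
        case True
        then obtain k where "k < p" "w ! k \<noteq> X"
          by (auto simp: list_eq_iff_nth_eq)
        then have k: "k < p" "w ! k = Y"
          by (auto intro: letter.exhaust)
        \<comment> \<open>The start of a window of three letters that contains position
          \<open>k\<close> and still fits into the word when \<open>k\<close> is near its
          end.\<close>
        define i where "i = min k (p - 3)"
        have i: "i + 3 \<le> p" "k = i \<or> k = i + 1 \<or> k = i + 2"
          using k p by (auto simp: i_def)
        have "drop j w = w ! j # drop (Suc j) w" if "j < i + 3" for j
          using that i(1) True by (simp add: Cons_nth_drop_Suc)
        from this[of i] this[of "i + 1"] this[of "i + 2"]
        have "drop i w = w ! i # w ! (i + 1) # w ! (i + 2) # drop (i + 3) w"
          by (simp add: numeral_eq_Suc)
        then have w: "take i w @ w ! i # w ! (i + 1) # w ! (i + 2) # drop (i + 3) w = w"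
          using append_take_drop_id[of i w] by (simp only:)
        have "Poly_Mapping.lookup f (take i w @ w ! i # w ! (i + 1) # w ! (i + 2) # drop (i + 3) w) = 0"
          using True i k by (intro zero) auto
        then have "Poly_Mapping.lookup f w = 0"
          unfolding w .
        with True show ?thesis
          by (simp add: gen_power lookup_single when_def)
      qed (auto simp: gen_power lookup_single when_def lookup_tpow_eq_0[OF tp])
    qed
    also have "\<dots> \<in> tensor.span {gen X ^ p}"
      by (intro tensor.span_scale tensor.span_base) simp
    finally show "f \<in> tensor.span {gen X ^ p}" .
  qed
qed

section \<open>Chains and the differential in terms of coefficients in the algebra\<close>

lemma lookup_tensor_elem [simp]: "Poly_Mapping.lookup (a \<boxtimes> f) w = ascale (Poly_Mapping.lookup f w) a"
  by (simp add: tensor_elem_def Poly_Mapping.map.rep_eq when_def)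

lemma tensor_elem_add_left: "(a + b) \<boxtimes> f = a \<boxtimes> f + b \<boxtimes> f"
  and tensor_elem_diff_left: "(a - b) \<boxtimes> f = a \<boxtimes> f - b \<boxtimes> f"
  and tensor_elem_add_right: "a \<boxtimes> (f + g) = a \<boxtimes> f + a \<boxtimes> g"
  and tensor_elem_diff_right: "a \<boxtimes> (f - g) = a \<boxtimes> f - a \<boxtimes> g"
  and tensor_elem_tscale: "a \<boxtimes> tscale c f = ascale c a \<boxtimes> f"
  and cscale_tensor_elem: "cscale c (a \<boxtimes> f) = ascale c a \<boxtimes> f"
  and tensor_elem_0_left [simp]: "0 \<boxtimes> f = 0"
  and tensor_elem_single: "a \<boxtimes> Poly_Mapping.single w c = Poly_Mapping.single w (ascale c a)"
  by (auto intro!: poly_mapping_eqI simp: lookup_add lookup_minus A.scale_right_distrib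
      A.scale_right_diff_distrib A.scale_left_distrib A.scale_left_diff_distrib mult.commute
      lookup_single when_def)

text \<open>Every chain is thus encoded by two elements of \<open>A\<close>. The case f = g is
  allowed and yields \<open>chains_singleton\<close>.\<close>

lemma chains_pair:
  assumes "koszul_W rels p = tensor.span {f, g}"
  shows "chains p = {a \<boxtimes> f + b \<boxtimes> g | a b. True}" (is "_ = ?C")
proof
  have "chain.subspace ?C"
  proof (rule chain.subspaceI)
    have "0 = 0 \<boxtimes> f + 0 \<boxtimes> g" by simp
    then show "0 \<in> ?C" by blast
  next
    fix y z assume "y \<in> ?C" "z \<in> ?C"
    then obtain a b c d where "y = a \<boxtimes> f + b \<boxtimes> g" "z = c \<boxtimes> f + d \<boxtimes> g" by blast
    then have "y + z = (a + c) \<boxtimes> f + (b + d) \<boxtimes> g"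
      by (simp add: tensor_elem_add_left)
    then show "y + z \<in> ?C" by blast
  next
    fix k z assume "z \<in> ?C"
    then obtain c d where "z = c \<boxtimes> f + d \<boxtimes> g" by blast
    then have "cscale k z = ascale k c \<boxtimes> f + ascale k d \<boxtimes> g"
      by (simp add: cscale_tensor_elem chain.scale_right_distrib)
    then show "cscale k z \<in> ?C" by blast
  qed
  moreover have "a \<boxtimes> h \<in> ?C" if "h \<in> koszul_W rels p" for a h
  proof -
    from that obtain c d where "h - tscale c f = tscale d g"
      unfolding assms tensor.span_insert[of f] tensor.span_singleton by blast
    then have "h = tscale c f + tscale d g"
      by (simp add: algebra_simps)
    then have "a \<boxtimes> h = ascale c a \<boxtimes> f + ascale d a \<boxtimes> g"
      by (simp add: tensor_elem_add_right tensor_elem_tscale)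
    then show ?thesis by blast
  qed
  ultimately show "chains p \<subseteq> ?C"
    unfolding chains_def by (intro chain.span_minimal) auto
  have "a \<boxtimes> h \<in> chains p" if "h \<in> {f, g}" for a h
    unfolding chains_def assms using that by (intro chain.span_base) (blast intro: tensor.span_base)
  then show "?C \<subseteq> chains p"
    by (auto intro!: chain.subspace_add[OF subspace_chains])
qed

lemma chains_singleton:
  assumes "koszul_W rels p = tensor.span {f}"
  shows "chains p = {a \<boxtimes> f | a. True}"
proof -
  have "chains p = {a \<boxtimes> f + b \<boxtimes> f | a b. True}"
    using assms by (intro chains_pair) simp
  also have "\<dots> = {a \<boxtimes> f | a. True}"
  proof -
    have "a \<boxtimes> f = a \<boxtimes> f + 0 \<boxtimes> f" for a
      by simp
    then show ?thesis
      unfolding tensor_elem_add_left[symmetric] by blast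
  qed
  finally show ?thesis .
qed

lemmas chains_0 = chains_singleton[OF koszul_W_0]
  and chains_1 = chains_pair[OF koszul_W_1]
  and chains_2 = chains_pair[OF koszul_W_2]
  and chains_ge_3 = chains_singleton[OF koszul_W_ge_3]

lemma tensor_elem_one: "a \<boxtimes> 1 = Poly_Mapping.single [] a"
  by (simp add: tensor_elem_single flip: single_one zero_list_def)

lemma tensor_elem_gen: "a \<boxtimes> gen v = Poly_Mapping.single [v] a"
  by (simp add: gen_def tensor_elem_single)

lemma b_K_0: "b_K (a \<boxtimes> 1) = 0"
  by (simp add: tensor_elem_one b_K_single)

lemma b_K_1: "b_K (a \<boxtimes> gen X + b \<boxtimes> gen Y) = (a * xA - xA * a + (b * yA - yA * b)) \<boxtimes> 1"
  by (simp add: b_K_add b_K_single tensor_elem_one tensor_elem_gen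
      add_ac flip: xA_def yA_def single_add single_diff)

lemma b_K_diff: "b_K (y - z) = b_K y - b_K z"
  using b_K_add[of "y - z" z] by simp

text \<open>The summand -xy couples the components: removing its left letter gives -bx at y,
  removing its right letter gives -yb at x.\<close>

lemma b_K_2:
  "b_K (a \<boxtimes> gen X ^ 2 + b \<boxtimes> (gen Y ^ 2 - gen X * gen Y))
    = (a * xA + xA * a - yA * b) \<boxtimes> gen X + (b * yA + yA * b - b * xA) \<boxtimes> gen Y"
proof -
  have "a \<boxtimes> gen X ^ 2 + b \<boxtimes> (gen Y ^ 2 - gen X * gen Y)
      = Poly_Mapping.single [X, X] a + (Poly_Mapping.single [Y, Y] b - Poly_Mapping.single [X, Y] b)"
    by (simp add: power2_eq_square gen_times_gen tensor_elem_diff_right tensor_elem_single)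
  then show ?thesis
    by (simp add: b_K_add b_K_diff b_K_single tensor_elem_gen single_add single_diff
        flip: xA_def yA_def)
qed

text \<open>Removing the first or the last letter of a power of x leaves the same word, so both
  terms merge: a commutator with x for even \<open>p\<close>, an anticommutator for odd
  \<open>p\<close>.\<close>

lemma b_K_power: "b_K (a \<boxtimes> gen X ^ Suc p) = (a * xA + (- 1) ^ Suc p * (xA * a)) \<boxtimes> gen X ^ p"
proof -
  have "butlast (replicate (Suc p) X) = replicate p X"
    by (induct p) simp_all
  moreover have "last (replicate (Suc p) X) = X"
    by simp
  ultimately show ?thesis
    unfolding gen_power tensor_elem_single
    by (simp add: b_K_single xA_def flip: single_add single_diff del: last_replicate butlast.simps last.simps)
qed

lemma tensor_elem_power_eq_iff: "a \<boxtimes> gen X ^ p = b \<boxtimes> gen X ^ p \<longleftrightarrow> a = b"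
proof
  assume "a \<boxtimes> gen X ^ p = b \<boxtimes> gen X ^ p"
  then have "Poly_Mapping.lookup (a \<boxtimes> gen X ^ p) (replicate p X) = Poly_Mapping.lookup (b \<boxtimes> gen X ^ p) (replicate p X)"
    by simp
  then show "a = b"
    by (simp add: gen_power)
qed simp

lemma tensor_elem_1_eq_iff:
  "a \<boxtimes> gen X + b \<boxtimes> gen Y = c \<boxtimes> gen X + d \<boxtimes> gen Y \<longleftrightarrow> a = c \<and> b = d"
proof
  assume *: "a \<boxtimes> gen X + b \<boxtimes> gen Y = c \<boxtimes> gen X + d \<boxtimes> gen Y" (is "?l = ?r")
  have "Poly_Mapping.lookup ?l w = Poly_Mapping.lookup ?r w" for w
    by (simp only: *)
  from this[of "[X]"] this[of "[Y]"] show "a = c \<and> b = d"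
    by (simp add: gen_def lookup_add lookup_single)
qed simp

lemma tensor_elem_2_eq_iff:
  "a \<boxtimes> gen X ^ 2 + b \<boxtimes> (gen Y ^ 2 - gen X * gen Y)
    = c \<boxtimes> gen X ^ 2 + d \<boxtimes> (gen Y ^ 2 - gen X * gen Y) \<longleftrightarrow> a = c \<and> b = d" (is "?l = ?r \<longleftrightarrow> _")
proof
  assume *: "?l = ?r"
  have "Poly_Mapping.lookup ?l w = Poly_Mapping.lookup ?r w" for w
    by (simp only: *)
  \<comment> \<open>Each of these words occurs in exactly one of the two basis tensors.\<close>
  from this[of "[X, X]"] this[of "[Y, Y]"] show "a = c \<and> b = d"
    by (simp add: power2_eq_square gen_times_gen lookup_add lookup_minus lookup_single)
qed simp

section \<open>Cycles and boundaries in each degree\<close>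

lemma cycles_0: "cycles 0 = {a \<boxtimes> 1 | a. True}"
  by (auto simp: cycles_def chains_0 b_K_0)

lemma boundaries_0: "boundaries 0 = {(a * xA - xA * a + (b * yA - yA * b)) \<boxtimes> 1 | a b. True}"
  unfolding boundaries_def One_nat_def[symmetric] chains_1 by (force simp: b_K_1)

lemma cycles_1:
  "cycles 1 = {a \<boxtimes> gen X + b \<boxtimes> gen Y | a b. a * xA - xA * a + (b * yA - yA * b) = 0}"
proof -
  have "c \<boxtimes> 1 = 0 \<longleftrightarrow> c = 0" for c :: "'a A"
    \<comment> \<open>The unit tensor is the zeroth power of x.\<close>
    using tensor_elem_power_eq_iff[of c 0 0] by simp
  moreover have "cycles 1 = {a \<boxtimes> gen X + b \<boxtimes> gen Y | a b. b_K (a \<boxtimes> gen X + b \<boxtimes> gen Y) = (0 :: 'a chain)}"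
    unfolding cycles_def chains_1 by blast
  ultimately show ?thesis
    by (simp only: b_K_1)
qed

lemma boundaries_1:
  "boundaries 1 = {(a * xA + xA * a - yA * b) \<boxtimes> gen X + (b * yA + yA * b - b * xA) \<boxtimes> gen Y | a b. True}"
  unfolding boundaries_def Suc_1 chains_2 by (force simp: b_K_2)

lemma cycles_2:
  "cycles 2 = {a \<boxtimes> gen X ^ 2 + b \<boxtimes> (gen Y ^ 2 - gen X * gen Y) | a b.
     a * xA + xA * a - yA * b = 0 \<and> b * yA + yA * b - b * xA = 0}"
proof -
  have "c \<boxtimes> gen X + d \<boxtimes> gen Y = 0 \<longleftrightarrow> c = 0 \<and> d = 0" for c d :: "'a A"
    using tensor_elem_1_eq_iff[of c d 0 0] by simp
  moreover have "cycles 2 = {a \<boxtimes> gen X ^ 2 + b \<boxtimes> (gen Y ^ 2 - gen X * gen Y) | a b.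
      b_K (a \<boxtimes> gen X ^ 2 + b \<boxtimes> (gen Y ^ 2 - gen X * gen Y)) = (0 :: 'a chain)}"
    unfolding cycles_def chains_2 by blast
  ultimately show ?thesis
    by (simp only: b_K_2)
qed

text \<open>Degree 2 is included because the chains one degree higher already have a single
  component; 2-cycles still have two.\<close>

lemma boundaries_ge_2:
  assumes "2 \<le> p"
  shows "boundaries p = {(a * xA + (- 1) ^ Suc p * (xA * a)) \<boxtimes> gen X ^ p | a. True}"
proof -
  have *: "chains (Suc p) = {a \<boxtimes> gen X ^ Suc p | a. True}"
    using assms by (intro chains_ge_3) simp
  have "boundaries p = {b_K (a \<boxtimes> gen X ^ Suc p) | a. True}"
    unfolding boundaries_def * by blast
  then show ?thesis
    by (simp only: b_K_power)
qed

lemma cycles_ge_3: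
  assumes "3 \<le> p"
  shows "cycles p = {a \<boxtimes> gen X ^ p | a. a * xA + (- 1) ^ p * (xA * a) = 0}"
proof -
  obtain q where p: "p = Suc q"
    using assms by (cases p) auto
  have "c \<boxtimes> gen X ^ q = 0 \<longleftrightarrow> c = 0" for c :: "'a A"
    using tensor_elem_power_eq_iff[of c q 0] by simp
  moreover have "cycles p = {a \<boxtimes> gen X ^ p | a. b_K (a \<boxtimes> gen X ^ p) = (0 :: 'a chain)}"
    unfolding cycles_def chains_ge_3[OF assms] by blast
  ultimately show ?thesis
    by (simp only: b_K_power p)
qed

section \<open>The Koszul homology of \<open>A\<close>\<close>

lemma HK_0:
  "HK_dim_generators 0 4 ({1 \<boxtimes> 1, xA \<boxtimes> 1, yA \<boxtimes> 1, (xA * yA) \<boxtimes> 1} :: 'k::field_char_0 chain set)"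
proof -
  let ?gs = "[1 \<boxtimes> 1, xA \<boxtimes> 1, yA \<boxtimes> 1, (xA * yA) \<boxtimes> 1] :: 'k chain list"
  have sum: "(\<Sum>i<length ?gs. cscale (c i) (?gs ! i)) = mkA (c 0) (c 1) (c 2) (c 3) 0 0 \<boxtimes> 1" for c
    by (simp add: mkA_def eval_nat_numeral cscale_tensor_elem tensor_elem_add_left)
  have "HK_dim_generators 0 (length ?gs) (set ?gs)"
  proof (rule HK_dim_generatorsI)
    show "set ?gs \<subseteq> cycles 0"
      by (auto simp: cycles_0)
  next
    fix z :: "'k chain" assume "z \<in> cycles 0"
    then obtain a where z: "z = a \<boxtimes> 1"
      by (auto simp: cycles_0)
    \<comment> \<open>The functionals \<open>c1\<close>, \<open>cx\<close>, \<open>cy\<close> and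
      \<open>cxy + cyx\<close> vanish on all commutators with x and y. The rest is a commutator with
      x, since [y, x] = yx - xy and [xy, x] = xyx.\<close>
    let ?c = "\<lambda>i. [c1 a, cx a, cy a, cxy a + cyx a] ! i"
    let ?u = "mkA 0 0 (cyx a) (cxyx a) 0 0"
    have "a - mkA (?c 0) (?c 1) (?c 2) (?c 3) 0 0 = ?u * xA - xA * ?u + (0 * yA - yA * 0)"
      by (simp add: A_eq_iff)
    then have "z - (\<Sum>i<length ?gs. cscale (?c i) (?gs ! i))
        = (?u * xA - xA * ?u + (0 * yA - yA * 0)) \<boxtimes> 1"
      unfolding sum z tensor_elem_diff_left[symmetric] by (simp only:)
    then have "z - (\<Sum>i<length ?gs. cscale (?c i) (?gs ! i)) \<in> boundaries 0"
      unfolding boundaries_0 by blast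
    then show "\<exists>c. z - (\<Sum>i<length ?gs. cscale (c i) (?gs ! i)) \<in> boundaries 0"
      by (rule exI[where x = ?c])
  next
    fix c i assume "(\<Sum>i<length ?gs. cscale (c i) (?gs ! i)) \<in> boundaries 0" and i: "i < length ?gs"
    then obtain a b where "mkA (c 0) (c 1) (c 2) (c 3) 0 0 \<boxtimes> 1
        = (a * xA - xA * a + (b * yA - yA * b)) \<boxtimes> (1 :: (letter, 'k) tensor_alg)"
      unfolding sum boundaries_0 by blast
    then have "mkA (c 0) (c 1) (c 2) (c 3) 0 0 = a * xA - xA * a + (b * yA - yA * b)"
      using tensor_elem_power_eq_iff[of _ 0 "a * xA - xA * a + (b * yA - yA * b)"] by simp
    then have "c 0 = 0 \<and> c 1 = 0 \<and> c 2 = 0 \<and> c 3 = 0"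
      by (simp add: A_eq_iff)
    with i show "c i = 0"
      by (auto simp: less_Suc_eq eval_nat_numeral)
  qed
  then show ?thesis
    by (simp add: eval_nat_numeral)
qed

lemma HK_1:
  "HK_dim_generators 1 3 ({1 \<boxtimes> gen X, 1 \<boxtimes> gen Y, yA \<boxtimes> gen Y} :: 'k::field_char_0 chain set)"
proof -
  let ?gs = "[1 \<boxtimes> gen X, 1 \<boxtimes> gen Y, yA \<boxtimes> gen Y] :: 'k chain list"
  have sum: "(\<Sum>i<length ?gs. cscale (c i) (?gs ! i))
      = mkA (c 0) 0 0 0 0 0 \<boxtimes> gen X + mkA (c 1) 0 (c 2) 0 0 0 \<boxtimes> gen Y" for c
    by (simp add: mkA_def eval_nat_numeral cscale_tensor_elem tensor_elem_add_left)
  have "HK_dim_generators 1 (length ?gs) (set ?gs)"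
  proof (rule HK_dim_generatorsI)
    have "mkA 1 0 0 0 0 0 \<boxtimes> gen X + mkA 0 0 0 0 0 0 \<boxtimes> gen Y \<in> (cycles 1 :: 'k chain set)"
      "mkA 0 0 0 0 0 0 \<boxtimes> gen X + mkA 1 0 0 0 0 0 \<boxtimes> gen Y \<in> (cycles 1 :: 'k chain set)"
      "mkA 0 0 0 0 0 0 \<boxtimes> gen X + mkA 0 0 1 0 0 0 \<boxtimes> gen Y \<in> (cycles 1 :: 'k chain set)"
      unfolding cycles_1 by (rule CollectI, intro exI conjI, rule refl, simp add: A_eq_iff)+
    then show "set ?gs \<subseteq> cycles 1"
      by (simp add: mkA_def)
  next
    fix z :: "'k chain" assume "z \<in> cycles 1"
    then obtain a b where z: "z = a \<boxtimes> gen X + b \<boxtimes> gen Y"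
      and cycle: "a * xA - xA * a + (b * yA - yA * b) = 0"
      unfolding cycles_1 by (elim CollectE exE conjE)
    \<comment> \<open>These two coordinates carry the whole cycle condition: the \<open>cxy\<close>
      coordinate is the negative of the \<open>cyx\<close> one, and the others vanish
      identically.\<close>
    have "cyx (a * xA - xA * a + (b * yA - yA * b)) = 0"
      "cxyx (a * xA - xA * a + (b * yA - yA * b)) = 0"
      by (simp_all only: cycle coord_zero)
    then have ab: "cx b = cy a" "cyx b = cxy a - cyx a"
      by simp_all
    \<comment> \<open>The last entry vanishes on boundaries: a scalar t in the second component of a
      2-chain contributes -t to \<open>cy a\<close> and 2t to \<open>cy b\<close>.\<close>
    let ?c = "\<lambda>i. [c1 a, c1 b, cy b + 2 * cy a] ! i"
    \<comment> \<open>The second component is matched first, by inverting the matrix of determinant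
      -3 on the span of x, y. Then \<open>?u\<close> corrects the first component, where the scalar
      1 contributes 2x.\<close>
    let ?v = "mkA (- cy a) ((cxy b + 2 * cyx b) / 3) ((cxy b - cyx b) / 3) (- cxyx b) 0 0"
    let ?u = "mkA (cx a / 2) 0 (cxy a + (cxy b - cyx b) / 3) (cxyx a) 0 0"
    have "a - mkA (?c 0) 0 0 0 0 0 = ?u * xA + xA * ?u - yA * ?v"
      "b - mkA (?c 1) 0 (?c 2) 0 0 0 = ?v * yA + yA * ?v - ?v * xA"
      by (simp_all add: A_eq_iff ab) (simp_all add: field_simps)
    moreover have "z - (\<Sum>i<length ?gs. cscale (?c i) (?gs ! i))
        = (a - mkA (?c 0) 0 0 0 0 0) \<boxtimes> gen X + (b - mkA (?c 1) 0 (?c 2) 0 0 0) \<boxtimes> gen Y"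
      unfolding sum z tensor_elem_diff_left by simp
    ultimately have "z - (\<Sum>i<length ?gs. cscale (?c i) (?gs ! i))
        = (?u * xA + xA * ?u - yA * ?v) \<boxtimes> gen X + (?v * yA + yA * ?v - ?v * xA) \<boxtimes> gen Y"
      by (simp only:)
    then have "z - (\<Sum>i<length ?gs. cscale (?c i) (?gs ! i)) \<in> boundaries 1"
      unfolding boundaries_1 by blast
    then show "\<exists>c. z - (\<Sum>i<length ?gs. cscale (c i) (?gs ! i)) \<in> boundaries 1"
      by (rule exI[where x = ?c])
  next
    fix c i assume "(\<Sum>i<length ?gs. cscale (c i) (?gs ! i)) \<in> boundaries 1" and i: "i < length ?gs"
    then obtain a b :: "'k A" where "mkA (c 0) 0 0 0 0 0 = a * xA + xA * a - yA * b"
      "mkA (c 1) 0 (c 2) 0 0 0 = b * yA + yA * b - b * xA"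
      unfolding sum boundaries_1 mem_Collect_eq tensor_elem_1_eq_iff by blast
    then have "c 0 = 0 \<and> c 1 = 0 \<and> c 2 = 0"
      by (simp add: A_eq_iff)
    with i show "c i = 0"
      by (auto simp: less_Suc_eq eval_nat_numeral)
  qed
  then show ?thesis
    by (simp add: eval_nat_numeral)
qed

lemma HK_2:
  "HK_dim_generators 2 3
     ({xA \<boxtimes> (gen X)^2,
       (yA * xA) \<boxtimes> (gen X)^2 + (xA * yA + yA * xA) \<boxtimes> ((gen Y)^2 - gen X * gen Y),
       (xA * yA * xA) \<boxtimes> ((gen Y)^2 - gen X * gen Y)} :: 'k::field_char_0 chain set)"
proof -
  let ?r = "(gen Y)^2 - gen X * gen Y :: (letter, 'k) tensor_alg"
  let ?gs = "[xA \<boxtimes> (gen X)^2, (yA * xA) \<boxtimes> (gen X)^2 + (xA * yA + yA * xA) \<boxtimes> ?r,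
    (xA * yA * xA) \<boxtimes> ?r] :: 'k chain list"
  have sum: "(\<Sum>i<length ?gs. cscale (c i) (?gs ! i))
      = mkA 0 (c 0) 0 0 (c 1) 0 \<boxtimes> (gen X)^2 + mkA 0 0 0 (c 1) (c 1) (c 2) \<boxtimes> ?r" for c
  proof -
    have "{..<length ?gs} = {0, 1, 2}"
      by auto
    then show ?thesis
      by (simp add: mkA_def cscale_tensor_elem tensor_elem_add_left chain.scale_right_distrib
          del: list.size)
  qed
  have "HK_dim_generators 2 (length ?gs) (set ?gs)"
  proof (rule HK_dim_generatorsI)
    have "mkA 0 1 0 0 0 0 \<boxtimes> gen X ^ 2 + mkA 0 0 0 0 0 0 \<boxtimes> ?r \<in> (cycles 2 :: 'k chain set)"
      "mkA 0 0 0 0 1 0 \<boxtimes> gen X ^ 2 + mkA 0 0 0 1 1 0 \<boxtimes> ?r \<in> (cycles 2 :: 'k chain set)"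
      "mkA 0 0 0 0 0 0 \<boxtimes> gen X ^ 2 + mkA 0 0 0 0 0 1 \<boxtimes> ?r \<in> (cycles 2 :: 'k chain set)"
      unfolding cycles_2 by (rule CollectI, intro exI conjI, rule refl; simp add: A_eq_iff)+
    then show "set ?gs \<subseteq> cycles 2"
      by (simp add: mkA_def)
  next
    fix z :: "'k chain" assume "z \<in> cycles 2"
    then obtain a b where z: "z = a \<boxtimes> gen X ^ 2 + b \<boxtimes> ?r"
      and "a * xA + xA * a - yA * b = 0" "b * yA + yA * b - b * xA = 0"
      unfolding cycles_2 by (elim CollectE exE conjE)
    then have eqs: "c1 a = 0" "cy a = 0" "cxy a + cyx a = cyx b" "c1 b = 0" "cx b + 2 * cy b = 0"
      "cx b = cy b" "cxy b = cyx b"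
      by (auto simp: A_eq_iff algebra_simps)
    \<comment> \<open>Injectivity of the same matrix: its two equations leave only a multiple of
      3.\<close>
    then have "3 * cy b = 0"
      by (simp add: algebra_simps)
    with eqs have ab: "c1 a = 0" "cy a = 0" "cyx b = cxy a + cyx a" "cxy b = cxy a + cyx a"
      "c1 b = 0" "cx b = 0" "cy b = 0"
      by simp_all
    let ?c = "\<lambda>i. [cx a, cxy a + cyx a, cxyx b] ! i"
    \<comment> \<open>Boundaries reach only the first component, through commutators with x. What
      remains there is a multiple of xy - yx = -[y, x] plus a multiple of xyx = [xy, x].\<close>
    let ?u = "mkA 0 0 (- cxy a) (cxyx a) 0 0"
    have "a - mkA 0 (?c 0) 0 0 (?c 1) 0 = ?u * xA + (- 1) ^ Suc 2 * (xA * ?u)"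
      "b - mkA 0 0 0 (?c 1) (?c 1) (?c 2) = 0"
      by (simp_all add: A_eq_iff numeral_2_eq_2 ab)
    moreover have "z - (\<Sum>i<length ?gs. cscale (?c i) (?gs ! i))
        = (a - mkA 0 (?c 0) 0 0 (?c 1) 0) \<boxtimes> gen X ^ 2 + (b - mkA 0 0 0 (?c 1) (?c 1) (?c 2)) \<boxtimes> ?r"
      unfolding sum z tensor_elem_diff_left by simp
    ultimately have "z - (\<Sum>i<length ?gs. cscale (?c i) (?gs ! i))
        = (?u * xA + (- 1) ^ Suc 2 * (xA * ?u)) \<boxtimes> gen X ^ 2"
      by (simp only: tensor_elem_0_left add_0_right)
    then have "z - (\<Sum>i<length ?gs. cscale (?c i) (?gs ! i)) \<in> boundaries 2"
      unfolding boundaries_ge_2[OF order_refl] by blast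
    then show "\<exists>c. z - (\<Sum>i<length ?gs. cscale (c i) (?gs ! i)) \<in> boundaries 2"
      by (rule exI[where x = ?c])
  next
    fix c i assume "(\<Sum>i<length ?gs. cscale (c i) (?gs ! i)) \<in> boundaries 2" and i: "i < length ?gs"
    then obtain a :: "'k A" where "mkA 0 (c 0) 0 0 (c 1) 0 \<boxtimes> gen X ^ 2 + mkA 0 0 0 (c 1) (c 1) (c 2) \<boxtimes> ?r
        = (a * xA + (- 1) ^ Suc 2 * (xA * a)) \<boxtimes> gen X ^ 2 + 0 \<boxtimes> ?r"
      unfolding sum boundaries_ge_2[OF order_refl] by auto
    then have "mkA 0 (c 0) 0 0 (c 1) 0 = a * xA + (- 1) ^ Suc 2 * (xA * a)"
      "mkA 0 0 0 (c 1) (c 1) (c 2) = 0"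
      unfolding tensor_elem_2_eq_iff by blast+
    then have "c 0 = 0 \<and> c 1 = 0 \<and> c 2 = 0"
      by (simp add: A_eq_iff)
    with i show "c i = 0"
      by (auto simp: less_Suc_eq numeral_2_eq_2)
  qed
  then show ?thesis
    by (simp add: numeral_3_eq_3 del: One_nat_def)
qed

text \<open>Commutator and anticommutator with x alternate. The kernel of the former is spanned by
  1, x, xy + yx, xyx and the image of the latter by the last three; the kernel of the latter is
  spanned by x, xy - yx, xyx and the image of the former by the last two.\<close>

lemma HK_ge_3:
  assumes p: "3 \<le> p"
  shows "HK_dim_generators p 1 ({(if odd p then 1 else xA) \<boxtimes> gen X ^ p} :: 'k::field_char_0 chain set)"
proof -
  define g :: "'k A" where g: "g = (if odd p then 1 else xA)"
  let ?gs = "[g \<boxtimes> gen X ^ p]"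
  have B: "boundaries p = {(a * xA + (- 1) ^ Suc p * (xA * a)) \<boxtimes> gen X ^ p | a. True}"
    using p by (intro boundaries_ge_2) simp
  have sum: "(\<Sum>i<length ?gs. cscale (c i) (?gs ! i)) = ascale (c 0) g \<boxtimes> gen X ^ p" for c
    by (simp add: cscale_tensor_elem)
  have "HK_dim_generators p (length ?gs) (set ?gs)"
  proof (rule HK_dim_generatorsI)
    have "g * xA + (- 1) ^ p * (xA * g) = 0"
      by (simp add: g A_eq_iff)
    then show "set ?gs \<subseteq> cycles p"
      by (auto simp: cycles_ge_3[OF p])
  next
    fix z :: "'k chain" assume "z \<in> cycles p"
    then obtain a where z: "z = a \<boxtimes> gen X ^ p" and a: "a * xA + (- 1) ^ p * (xA * a) = 0"
      unfolding cycles_ge_3[OF p] by blast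
    let ?c = "\<lambda>i::nat. if odd p then c1 a else cx a"
    \<comment> \<open>In odd degree x, xy + yx and xyx are the anticommutators of x with 1/2, y and
      xy. In even degree the commutator preimage is the one used in degree 2.\<close>
    let ?u = "if odd p then mkA (cx a / 2) 0 (cxy a) (cxyx a) 0 0 else mkA 0 0 (- cxy a) (cxyx a) 0 0"
    have "a - ascale (?c 0) g = ?u * xA + (- 1) ^ Suc p * (xA * ?u)"
      using a by (auto simp: A_eq_iff g add_eq_0_iff)
    then have "z - (\<Sum>i<length ?gs. cscale (?c i) (?gs ! i))
        = (?u * xA + (- 1) ^ Suc p * (xA * ?u)) \<boxtimes> gen X ^ p"
      unfolding sum z tensor_elem_diff_left[symmetric] by (simp only:)
    then have "z - (\<Sum>i<length ?gs. cscale (?c i) (?gs ! i)) \<in> boundaries p"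
      unfolding B by blast
    then show "\<exists>c. z - (\<Sum>i<length ?gs. cscale (c i) (?gs ! i)) \<in> boundaries p"
      by (rule exI[where x = ?c])
  next
    fix c i assume "(\<Sum>i<length ?gs. cscale (c i) (?gs ! i)) \<in> boundaries p" and i: "i < length ?gs"
    then obtain a where "ascale (c 0) g = a * xA + (- 1) ^ Suc p * (xA * a)"
      unfolding sum B mem_Collect_eq tensor_elem_power_eq_iff by blast
    then have "c 0 = 0"
      by (auto simp: A_eq_iff g split: if_splits)
    with i show "c i = 0"
      by simp
  qed
  then show ?thesis
    by (simp add: g)
qed

theorem proposition9p2:
  shows "HK_dim_generators 0 4
           ({1 \<boxtimes> 1, xA \<boxtimes> 1, yA \<boxtimes> 1, (xA * yA) \<boxtimes> 1} :: 'k::field_char_0 chain set)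
       \<and> HK_dim_generators 1 3
           ({1 \<boxtimes> gen X, 1 \<boxtimes> gen Y, yA \<boxtimes> gen Y} :: 'k chain set)
       \<and> HK_dim_generators 2 3
           ({xA \<boxtimes> (gen X)^2,
             (yA * xA) \<boxtimes> (gen X)^2 + (xA * yA + yA * xA) \<boxtimes> ((gen Y)^2 - gen X * gen Y),
             (xA * yA * xA) \<boxtimes> ((gen Y)^2 - gen X * gen Y)} :: 'k chain set)
       \<and> (\<forall>p\<ge>3. (odd p \<longrightarrow> HK_dim_generators p 1 ({1 \<boxtimes> (gen X)^p} :: 'k chain set))
               \<and> (even p \<longrightarrow> HK_dim_generators p 1 ({xA \<boxtimes> (gen X)^p} :: 'k chain set)))"
proof (intro conjI allI impI)
  fix p :: nat
  assume p: "3 \<le> p"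
  show "HK_dim_generators p 1 ({1 \<boxtimes> (gen X)^p} :: 'k chain set)" if "odd p"
    using HK_ge_3[OF p] that by simp
  show "HK_dim_generators p 1 ({xA \<boxtimes> (gen X)^p} :: 'k chain set)" if "even p"
    using HK_ge_3[OF p] that by simp
qed (rule HK_0 HK_1 HK_2)+

end
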